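(* For all integers $L\geq 1$ there exist integers $\ell,m\geq L$ such that there are infinitely many pairs $(a,b)$ of positive odd integers with $$s(a)=\ell, \quad s(b)=m, \quad \text{and} \quad s(ab)=4.$$
   Context: For a positive integer $n$, $s(n)$ denotes the number of nonzero digits in the binary expansion of $n$ (e.g. $s(23)=s((10111)_2)=4$). *)

theory Defs
  imports Main
begin

(* For a natural number n, the library predicate "bit n i" says that the coefficient of 2 ^ i in
   the binary expansion of n is 1 (it unfolds to "odd (n div 2 ^ i)"); the set of such i is finite
   (see finite_bits below), so "card" has its intended meaning. *)
definition s :: "nat \<Rightarrow> nat" where
  "s n = card {i. bit n i}"

lemma finite_bits: "finite {i. bit (n::nat) i}"
proof (rule finite_subset)
  show "{i. bit n i} \<subseteq> {..<n}"
  proof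
    fix i assume "i \<in> {i. bit n i}"
    then have "n div 2 ^ i \<noteq> 0"
      by (metis bit_iff_odd even_zero mem_Collect_eq)
    then have "2 ^ i \<le> n"
      by (simp add: div_eq_0_iff)
    then show "i \<in> {..<n}"
      by (meson lessThan_iff less_exp less_le_trans)
  qed
qed simp

lemma s_23: "s 23 = 4"
proof -
  have "i \<in> {0, 1, 2, 4}" if "bit (23::nat) i" for i
  proof -
    have "i < 5"
    proof (rule ccontr)
      assume "\<not> i < 5"
      then have "(2::nat) ^ 5 \<le> 2 ^ i"
        by (intro power_increasing) auto
      then show False
        using that by (simp add: bit_iff_odd)
    qed
    then have "i = 0 \<or> i = 1 \<or> i = 2 \<or> i = 3 \<or> i = 4" by auto
    then show ?thesis
      using that by (auto simp: bit_iff_odd)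
  qed
  then have "{i. bit (23::nat) i} = {0, 1, 2, 4}"
    by (auto simp: bit_iff_odd)
  then show ?thesis
    by (simp add: s_def)
qed

end

theory Submission
  imports Defs
begin

text \<open>
  If \<open>x * y = 2 ^ f + 1\<close>, then \<open>x\<close> and \<open>y * (1 + 2 ^ k)\<close> have the product
  \<open>(2 ^ f + 1) * (2 ^ k + 1)\<close>, whose binary expansion has exactly four ones for large \<open>k\<close>. At the
  same time \<open>y * (1 + 2 ^ k)\<close> consists of two disjoint copies of the digits of \<open>y\<close>, so both digit
  sums stay constant as \<open>k\<close> grows. This yields infinitely many pairs from a single factorization,
  and it remains to factor some \<open>2 ^ f + 1\<close> into two factors that both have at least \<open>L\<close> ones.

  Such a factorization comes from \<open>f = 9 * L\<close>. With \<open>q = 2 ^ L\<close>,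
  \<open>q\<^sup>9 + 1 = (q + 1) * (q\<^sup>2 - q + 1) * (q\<^sup>6 - q\<^sup>3 + 1)\<close>.
  The negative middle coefficients produce runs of ones of length proportional to \<open>L\<close>, in
  \<open>q\<^sup>2 - q + 1\<close> as well as in the product of the other two factors.
\<close>

lemma s_add_shifted:
  assumes "n < 2 ^ k"
  shows "s (n + 2 ^ k * m) = s n + s m"
proof -
  have low: "bit (n + 2 ^ k * m) i \<longleftrightarrow> bit n i" if "i < k" for i
  proof -
    have "take_bit k (n + 2 ^ k * m) = n"
      using assms by (simp add: take_bit_eq_mod)
    then show ?thesis
      using that by (metis bit_take_bit_iff)
  qed
  have high: "bit (n + 2 ^ k * m) (k + j) \<longleftrightarrow> bit m j" for j
  proof -
    have "drop_bit k (n + 2 ^ k * m) = m"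
      using assms by (simp add: drop_bit_eq_div)
    then show ?thesis
      by (metis bit_drop_bit_eq comp_apply)
  qed
  have n_low: "i < k" if "bit n i" for i
    using that assms by (metis bit_take_bit_iff take_bit_nat_eq_self_iff)
  have "{i. bit (n + 2 ^ k * m) i} = {i. bit n i} \<union> (+) k ` {j. bit m j}"
  proof (rule set_eqI)
    fix i
    show "i \<in> {i. bit (n + 2 ^ k * m) i} \<longleftrightarrow> i \<in> {i. bit n i} \<union> (+) k ` {j. bit m j}"
    proof (cases "i < k")
      case True
      then show ?thesis by (auto simp: low)
    next
      case False
      then obtain j where "i = k + j" by (metis le_Suc_ex not_less)
      then show ?thesis using n_low[of i] by (auto simp: high)
    qed
  qed
  moreover have "{i. bit n i} \<inter> (+) k ` {j. bit m j} = {}"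
    using n_low by fastforce
  ultimately show ?thesis
    by (simp add: s_def card_Un_disjoint finite_bits card_image)
qed

lemma s_one: "s 1 = 1"
  by (simp add: s_def bit_1_iff del: One_nat_def)

lemma s_pow2_minus_1: "s (2 ^ g - 1) = g"
proof -
  have "{i. bit (2 ^ g - 1 :: nat) i} = {..<g}"
    by (auto simp: bit_mask_iff simp del: One_nat_def simp flip: mask_eq_exp_minus_1)
  then show ?thesis by (simp add: s_def)
qed

lemma s_times_1_plus_pow2:
  assumes "n < 2 ^ k"
  shows "s (n * (1 + 2 ^ k)) = 2 * s n"
  using s_add_shifted[OF assms, of n] by (simp add: algebra_simps)

text \<open>
  With \<open>q = 2 ^ g\<close> and \<open>z = q - 1\<close>, the first factor \<open>q\<^sup>2 - q + 1\<close> equals \<open>1 + q * z\<close>, and \<open>z\<close>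
  is a run of \<open>g\<close> ones. The second factor is
  \<open>(q + 1) * (q\<^sup>6 - q\<^sup>3 + 1) = (q + 1) + q\<^sup>3 * c\<close> with \<open>c = q\<^sup>4 + q\<^sup>3 - q - 1\<close>, and the lowest \<open>g\<close>
  digits of \<open>c\<close> are again those of \<open>z\<close>, because \<open>c = z + q * (q\<^sup>3 + q\<^sup>2 - 2)\<close>.
\<close>
lemma pow2_plus_1_factors_with_many_ones:
  assumes "g \<ge> 1"
  obtains x y where "x * y = 1 + 2 ^ (9 * g)" "s x \<ge> g" "s y \<ge> g"
proof -
  define q :: nat where "q = 2 ^ g"
  define z where "z = q - 1"
  have q2: "q \<ge> 2"
    using assms by (metis q_def power_increasing power_one_right one_le_numeral)
  then have qz: "q = z + 1" by (simp add: z_def)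
  have s_z: "s z = g" unfolding z_def q_def by (rule s_pow2_minus_1)
  \<comment> \<open>This is \<open>q\<^sup>3 + q\<^sup>2 - 2\<close> written without subtraction.\<close>
  define w where "w = z * (q\<^sup>2 + 2 * q + 2)"
  define c where "c = z + q * w"
  define x where "x = 1 + q * z"
  define y where "y = (1 + q) + q ^ 3 * c"
  have "x * y = 1 + q ^ 9"
    unfolding x_def y_def c_def w_def qz by algebra
  then have "x * y = 1 + 2 ^ (9 * g)"
    by (simp add: q_def power_mult[symmetric] mult.commute)
  moreover have "s x \<ge> g"
    using s_add_shifted[of 1 g z] q2 s_z by (simp add: x_def q_def)
  moreover have "s y \<ge> g"
  proof -
    have "s c \<ge> g"
      using s_add_shifted[of z g w] q2 s_z by (simp add: c_def q_def z_def)
    moreover have "1 + q < 2 ^ (3 * g)"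
    proof -
      have "1 + q < 2 * q" using q2 by simp
      also have "\<dots> \<le> q * q" using q2 by simp
      also have "\<dots> \<le> q * q * q" using q2 by simp
      also have "\<dots> = 2 ^ (3 * g)"
        by (simp add: q_def power_add[symmetric])
      finally show ?thesis .
    qed
    then have "s y = s (1 + q) + s c"
      using s_add_shifted[of "1 + q" "3 * g" c]
      by (simp add: y_def q_def power_mult[symmetric] mult.commute)
    ultimately show ?thesis by simp
  qed
  ultimately show thesis by (rule that)
qed

theorem theorem2p3:
  shows "\<forall>L::nat. L \<ge> 1 \<longrightarrow> (\<exists>l m::nat. l \<ge> L \<and> m \<ge> L \<and>
    infinite {(a::nat, b::nat). a > 0 \<and> b > 0 \<and> odd a \<and> odd b \<and>
      s a = l \<and> s b = m \<and> s (a * b) = 4})"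
proof (intro allI impI)
  fix L :: nat assume L: "L \<ge> 1"
  then obtain x y where xy: "x * y = 1 + 2 ^ (9 * L)" and sx: "s x \<ge> L" and sy: "s y \<ge> L"
    by (rule pow2_plus_1_factors_with_many_ones)
  have "odd (x * y)" using L by (simp add: xy)
  then have odd: "odd x" "odd y" by simp_all
  then have pos: "x > 0" "y > 0" by (auto intro: odd_pos)
  have s_xy: "s (x * y) = 2"
  proof -
    have "(1::nat) < 2 ^ (9 * L)"
      using L by (intro one_less_power) auto
    then show ?thesis
      using s_times_1_plus_pow2[of 1 "9 * L"] s_one by (simp add: xy)
  qed
  let ?S = "{(a::nat, b::nat). a > 0 \<and> b > 0 \<and> odd a \<and> odd b \<and>
      s a = s x \<and> s b = 2 * s y \<and> s (a * b) = 4}"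
  let ?f = "\<lambda>k. (x, y * (1 + 2 ^ k))"
  \<comment> \<open>From \<open>k = x * y\<close> on, the summands of \<open>n + 2 ^ k * n\<close> share no digit for \<open>n = y\<close>
      and \<open>n = x * y\<close>.\<close>
  have "?f k \<in> ?S" if "k \<ge> x * y" for k
  proof -
    have xy_less: "x * y < 2 ^ k"
      using that less_exp[of k] by linarith
    have "y \<le> x * y" using pos by simp
    then have y_less: "y < 2 ^ k" using xy_less by linarith
    have "k > 0" using that pos by (metis nat_0_less_mult_iff less_le_trans)
    moreover have "s (x * (y * (1 + 2 ^ k))) = 4"
      using s_times_1_plus_pow2[OF xy_less] s_xy by (simp add: algebra_simps)
    ultimately show ?thesis
      using odd pos s_times_1_plus_pow2[OF y_less] by auto
  qed
  then have "?f ` {x * y..} \<subseteq> ?S" by blast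
  moreover have "infinite (?f ` {x * y..})"
  proof -
    have "inj_on ?f {x * y..}" using pos by (auto simp: inj_on_def)
    then show ?thesis using infinite_Ici finite_imageD by blast
  qed
  ultimately have "infinite ?S" by (rule infinite_super)
  then show "\<exists>l m::nat. l \<ge> L \<and> m \<ge> L \<and>
    infinite {(a::nat, b::nat). a > 0 \<and> b > 0 \<and> odd a \<and> odd b \<and>
      s a = l \<and> s b = m \<and> s (a * b) = 4}"
    using sx sy by (intro exI[of _ "s x"] exI[of _ "2 * s y"]) simp
qed

end
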